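(* Let $R=(\mathbb{C},\mathbb{C}^4,\mathbb{C};u_0,\dots,u_3,v_0,\dots,v_3)$ be a representation of $\mathbf{Q}$ with dimension vector $(1,4,1)$. Then: (1) $R$ is globally injective if and only if $R$ has no subrepresentation of dimension vector $(1,b,1)$ with $b\in\{0,1,2,3\}$; (2) $R$ is globally surjective if and only if $R$ has no subrepresentation of dimension vector $(0,b,0)$ with $b\in\{1,2,3,4\}$.
   Context: The quiver $\mathbf{Q}$ has vertices $-1,0,1$, arrows $\eta_0,\dots,\eta_3:-1\to0$, $\phi_0,\dots,\phi_3:0\to1$ and relations $\phi_i\eta_j+\phi_j\eta_i=0$; a representation consists of vector spaces $V_{-1},V_0,V_1$ and linear maps $u_i:V_{-1}\to V_0$, $v_i:V_0\to V_1$ with $v_iu_j+v_ju_i=0$ for all $i,j$. $R$ is globally injective if $\sum_i\lambda_iu_i$ is injective for all $\lambda\in\mathbb{C}^4\setminus\{0\}$, and globally surjective if $\sum_i\lambda_iv_i$ is surjective for all $\lambda\in\mathbb{C}^4\setminus\{0\}$. *)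

theory Defs
  imports "HOL-Analysis.Analysis"
begin

text \<open>A representation of the quiver Q with dimension vector (1,4,1):
  V_{-1} = complex, V_0 = complex^4, V_1 = complex;
  u i : V_{-1} \<rightarrow> V_0 and v i : V_0 \<rightarrow> V_1 (i < 4) complex-linear maps with
  v_i u_j + v_j u_i = 0.\<close>

definition is_rep_141 :: "(nat \<Rightarrow> complex \<Rightarrow> complex^4) \<Rightarrow> (nat \<Rightarrow> complex^4 \<Rightarrow> complex) \<Rightarrow> bool" where
  "is_rep_141 u v \<longleftrightarrow>
     (\<forall>i<4. Vector_Spaces.linear ((*) :: complex \<Rightarrow> complex \<Rightarrow> complex) (*s) (u i)) \<and>
     (\<forall>i<4. Vector_Spaces.linear (*s) ((*) :: complex \<Rightarrow> complex \<Rightarrow> complex) (v i)) \<and>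
     (\<forall>i<4. \<forall>j<4. \<forall>t. v i (u j t) + v j (u i t) = 0)"

definition globally_injective :: "(nat \<Rightarrow> complex \<Rightarrow> complex^4) \<Rightarrow> bool" where
  "globally_injective u \<longleftrightarrow>
     (\<forall>lam :: nat \<Rightarrow> complex. (\<exists>i<4. lam i \<noteq> 0) \<longrightarrow>
        inj (\<lambda>t. \<Sum>i<4. lam i *s u i t))"

definition globally_surjective :: "(nat \<Rightarrow> complex^4 \<Rightarrow> complex) \<Rightarrow> bool" where
  "globally_surjective v \<longleftrightarrow>
     (\<forall>lam :: nat \<Rightarrow> complex. (\<exists>i<4. lam i \<noteq> 0) \<longrightarrow>
        surj (\<lambda>x. \<Sum>i<4. lam i * v i x))"

text \<open>Subrepresentation (W_{-1}, W_0, W_1) of dimension vector (a,b,c).\<close>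

definition has_subrep_dimvec ::
  "(nat \<Rightarrow> complex \<Rightarrow> complex^4) \<Rightarrow> (nat \<Rightarrow> complex^4 \<Rightarrow> complex) \<Rightarrow> nat \<Rightarrow> nat \<Rightarrow> nat \<Rightarrow> bool" where
  "has_subrep_dimvec u v a b c \<longleftrightarrow>
     (\<exists>(Wm :: complex set) (W0 :: (complex^4) set) (W1 :: complex set).
        vector_space_over_itself.subspace Wm \<and> vec.subspace W0 \<and>
        vector_space_over_itself.subspace W1 \<and>
        vector_space_over_itself.dim Wm = a \<and> vec.dim W0 = b \<and>
        vector_space_over_itself.dim W1 = c \<and>
        (\<forall>i<4. u i ` Wm \<subseteq> W0) \<and> (\<forall>i<4. v i ` W0 \<subseteq> W1))"

end

theory Submission
  imports Defs
begin

(* Only linearity of the maps enters.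
   Writing u_i t = t a_i, global injectivity says that a_0, ..., a_3 are linearly independent,
   i.e. that the square matrix with columns a_i is invertible, i.e. that the a_i lie in no proper
   subspace W_0 of C^4; such a W_0, together with W_{-1} = W_1 = C, is precisely a subrepresentation
   of dimension vector (1,b,1) with b < 4.  Dually, global surjectivity says that the functionals
   v_0, ..., v_3 are linearly independent.  As a square matrix is invertible iff its transpose is,
   this holds iff the v_i have no common zero x \<noteq> 0, and a subrepresentation of dimension vector
   (0,b,0) with b > 0 is precisely a nonzero subspace of the common kernel. *)

lemma inj_matrix_vector_mult_transpose_iff:
  fixes A :: "'a::field^'n^'n"
  shows "inj ((*v) (transpose A)) \<longleftrightarrow> inj ((*v) A)"
  using det_nz_iff_inj_gen[OF matrix_vector_mul_linear_gen, of A]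
    det_nz_iff_inj_gen[OF matrix_vector_mul_linear_gen, of "transpose A"]
  by (simp add: det_transpose)

lemma subspace_neq_UNIV_iff_dim_less:
  fixes W :: "('a::field^'n) set"
  assumes "vec.subspace W"
  shows "W \<noteq> UNIV \<longleftrightarrow> vec.dim W < CARD('n)"
proof -
  have dim_UNIV: "vec.dim (UNIV :: ('a^'n) set) = CARD('n)"
    by (rule vec_dim_card)
  have "vec.dim W \<le> CARD('n)"
    using dim_subset_UNIV_cart_gen[of W] by simp
  moreover have "W = UNIV" if "vec.dim W = CARD('n)"
    using vec.subspace_dim_equal[OF assms vec.subspace_UNIV] that dim_UNIV by simp
  ultimately show ?thesis
    using dim_UNIV by force
qed

lemma inj_matrix_vector_mult_iff_columns_span:
  fixes A :: "'a::field^'n^'n"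
  shows "inj ((*v) A) \<longleftrightarrow> (\<forall>W. vec.subspace W \<longrightarrow> (\<forall>j. column j A \<in> W) \<longrightarrow> W = UNIV)"
proof -
  have "inj ((*v) A) \<longleftrightarrow> surj ((*v) A)"
    using vec.linear_inj_imp_surj vec.linear_surj_imp_inj matrix_vector_mul_linear_gen
    by blast
  also have "\<dots> \<longleftrightarrow> (\<forall>W. vec.subspace W \<longrightarrow> (\<forall>j. column j A \<in> W) \<longrightarrow> W = UNIV)"
  proof
    assume surj: "surj ((*v) A)"
    show "\<forall>W. vec.subspace W \<longrightarrow> (\<forall>j. column j A \<in> W) \<longrightarrow> W = UNIV"
    proof (intro allI impI)
      fix W :: "('a^'n) set"
      assume W: "vec.subspace W" and cols: "\<forall>j. column j A \<in> W"
      have "A *v y \<in> W" for y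
        unfolding matrix_mult_sum using W cols
        by (intro vec.subspace_sum vec.subspace_scale) auto
      then show "W = UNIV"
        using surj by (metis UNIV_eq_I surjD)
    qed
  next
    assume "\<forall>W. vec.subspace W \<longrightarrow> (\<forall>j. column j A \<in> W) \<longrightarrow> W = UNIV"
    moreover have "vec.subspace (range ((*v) A))"
      by (intro vec.subspace_image vec.subspace_UNIV matrix_vector_mul_linear_gen)
    moreover have "column j A = A *v axis j 1" for j
      by (simp add: column_def matrix_vector_mult_def axis_def vec_eq_iff if_distrib cong: if_cong)
    ultimately show "surj ((*v) A)" by (metis rangeI)
  qed
  finally show ?thesis .
qed

lemma linear_functionals_independent_iff_no_common_zero:
  fixes f :: "'n::finite \<Rightarrow> 'a::field^'n \<Rightarrow> 'a"
  assumes lin: "\<And>j. Vector_Spaces.linear (*s) (*) (f j)"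
  shows "(\<forall>c. (\<forall>x. (\<Sum>j\<in>UNIV. c$j * f j x) = 0) \<longrightarrow> c = 0) \<longleftrightarrow>
         (\<forall>x. (\<forall>j. f j x = 0) \<longrightarrow> x = 0)"
proof -
  define M :: "'a^'n^'n" where "M = (\<chi> j k. f j (axis k 1))"
  have f_expand: "f j x = (\<Sum>k\<in>UNIV. x$k * f j (axis k 1))" for j x
  proof -
    have "f j x = f j (\<Sum>k\<in>UNIV. x$k *s axis k 1)"
      by (simp add: basis_expansion)
    also have "\<dots> = (\<Sum>k\<in>UNIV. x$k * f j (axis k 1))"
      using lin[of j, unfolded linear_iff_module_hom] by (simp add: module_hom.sum module_hom.scale)
    finally show ?thesis .
  qed
  have M_rows: "f j x = (M *v x) $ j" for x j
    by (simp add: M_def matrix_vector_mult_def f_expand[of j x] mult.commute)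
  have pairing: "(\<Sum>j\<in>UNIV. c$j * f j x) = (\<Sum>k\<in>UNIV. (transpose M *v c)$k * x$k)" for c x
    unfolding M_rows
    by (simp add: matrix_vector_mult_def transpose_def sum_distrib_left sum_distrib_right mult_ac)
      (rule sum.swap)
  have pairing_zero: "(\<forall>x. (\<Sum>k\<in>UNIV. w$k * x$k) = 0) \<longleftrightarrow> w = 0" for w :: "'a^'n"
  proof
    assume "\<forall>x. (\<Sum>k\<in>UNIV. w$k * x$k) = 0"
    then have "w$k = 0" for k
      by (auto dest: spec[of _ "axis k 1"] simp: axis_def if_distrib cong: if_cong)
    then show "w = 0"
      by (simp add: vec_eq_iff)
  qed simp
  have "(\<forall>c. (\<forall>x. (\<Sum>j\<in>UNIV. c$j * f j x) = 0) \<longrightarrow> c = 0) \<longleftrightarrow> inj ((*v) (transpose M))"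
    by (simp add: pairing pairing_zero vec.inj_iff_eq_0)
  also have "\<dots> \<longleftrightarrow> inj ((*v) M)"
    by (rule inj_matrix_vector_mult_transpose_iff)
  also have "\<dots> \<longleftrightarrow> (\<forall>x. (\<forall>j. f j x = 0) \<longrightarrow> x = 0)"
    by (simp add: vec.inj_iff_eq_0 vec_eq_iff M_rows)
  finally show ?thesis .
qed

lemma surj_iff_nonzero_if_homogeneous:
  fixes g :: "'a::field^'n \<Rightarrow> 'a"
  assumes homogeneous: "\<And>s x. g (s *s x) = s * g x"
  shows "surj g \<longleftrightarrow> (\<exists>x. g x \<noteq> 0)"
proof
  assume "surj g"
  then obtain x where "g x = 1"
    by (metis surjD)
  then show "\<exists>x. g x \<noteq> 0"
    by (metis one_neq_zero)
next
  assume "\<exists>x. g x \<noteq> 0"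
  then obtain x where "g x \<noteq> 0"
    by blast
  then have "g ((z / g x) *s x) = z" for z
    by (simp add: homogeneous)
  then show "surj g"
    by (rule surjI)
qed

(* The arrow with index i < 4 corresponds to the coordinate i + 1 of complex^4, whose index type
   4 has the elements 1, 2, 3, 4. *)
definition coord4 :: "nat \<Rightarrow> 4" where
  "coord4 i = of_nat (Suc i)"

definition idx4 :: "4 \<Rightarrow> nat" where
  "idx4 j = (if j = 1 then 0 else if j = 2 then 1 else if j = 3 then 2 else 3)"

lemma idx4_coord4 [simp]: "i < 4 \<Longrightarrow> idx4 (coord4 i) = i"
  by (auto simp: idx4_def coord4_def less_Suc_eq numeral_eq_Suc)

lemma coord4_idx4 [simp]: "coord4 (idx4 j) = j"
  using exhaust_4[of j] by (auto simp: idx4_def coord4_def)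

lemma idx4_less: "idx4 j < 4"
  by (simp add: idx4_def)

lemma bij_betw_idx4: "bij_betw idx4 UNIV {..<4}"
  by (rule bij_betw_byWitness[where f' = coord4]) (auto simp: idx4_less)

lemma sum_lessThan_4_idx4: "(\<Sum>i<4. f i) = (\<Sum>j\<in>UNIV. f (idx4 j))"
  using sum.reindex_bij_betw[OF bij_betw_idx4, of f] by simp

lemma all_lessThan_4_idx4: "(\<forall>i<4. P i) \<longleftrightarrow> (\<forall>j. P (idx4 j))"
  using idx4_less idx4_coord4 by metis

lemma all_nonzero_families_iff_all_nonzero_vectors:
  "(\<forall>lam :: nat \<Rightarrow> 'a::zero. (\<exists>i<4. lam i \<noteq> 0) \<longrightarrow> P (\<chi> j. lam (idx4 j))) \<longleftrightarrow>
   (\<forall>y :: 'a^4. y \<noteq> 0 \<longrightarrow> P y)"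
proof -
  have nonzero: "(\<chi> j. lam (idx4 j)) \<noteq> 0 \<longleftrightarrow> (\<exists>i<4. lam i \<noteq> 0)" for lam :: "nat \<Rightarrow> 'a"
  proof -
    have "(\<chi> j. lam (idx4 j)) = 0 \<longleftrightarrow> (\<forall>j. lam (idx4 j) = 0)"
      by (simp add: vec_eq_iff)
    also have "\<dots> \<longleftrightarrow> (\<forall>i<4. lam i = 0)"
      by (rule all_lessThan_4_idx4[symmetric])
    finally show ?thesis
      by blast
  qed
  have family: "(\<chi> j. y $ coord4 (idx4 j)) = y" for y :: "'a^4"
    by (simp add: vec_eq_iff)
  show ?thesis
  proof (intro iffI allI impI)
    fix y :: "'a^4"
    assume H: "\<forall>lam. (\<exists>i<4. lam i \<noteq> 0) \<longrightarrow> P (\<chi> j. lam (idx4 j))" and "y \<noteq> 0"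
    then have "\<exists>i<4. y $ coord4 i \<noteq> 0"
      using nonzero[of "\<lambda>i. y $ coord4 i"] by (simp add: family)
    then have "P (\<chi> j. y $ coord4 (idx4 j))"
      using H[rule_format, of "\<lambda>i. y $ coord4 i"] by simp
    then show "P y"
      by (simp only: family)
  next
    fix lam :: "nat \<Rightarrow> 'a"
    assume "\<forall>y. y \<noteq> 0 \<longrightarrow> P y" and "\<exists>i<4. lam i \<noteq> 0"
    then show "P (\<chi> j. lam (idx4 j))"
      using nonzero[of lam] by blast
  qed
qed

lemma rep_141_u_eq_scale:
  assumes "is_rep_141 u v" "i < 4"
  shows "u i t = t *s u i 1"
  using assms unfolding is_rep_141_def
  by (metis linear_iff_module_hom module_hom.scale mult.right_neutral)

lemma rep_141_v_scale:
  assumes "is_rep_141 u v" "i < 4"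
  shows "v i (s *s x) = s * v i x"
  using assms unfolding is_rep_141_def
  by (metis linear_iff_module_hom module_hom.scale)

lemma globally_injective_iff_inj_matrix:
  assumes rep: "is_rep_141 u v"
  shows "globally_injective u \<longleftrightarrow> inj ((*v) (\<chi> k j. u (idx4 j) 1 $ k))"
proof -
  let ?A = "\<chi> k j. u (idx4 j) 1 $ k"
  have combination: "(\<Sum>i<4. lam i *s u i t) = t *s (?A *v (\<chi> j. lam (idx4 j)))" for lam t
  proof -
    have "(\<Sum>i<4. lam i *s u i t) = t *s (\<Sum>i<4. lam i *s u i 1)"
      using rep_141_u_eq_scale[OF rep _, of _ t]
      by (simp add: vec.scale_sum_right vector_smult_assoc mult.commute)
    also have "(\<Sum>i<4. lam i *s u i 1) = ?A *v (\<chi> j. lam (idx4 j))"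
      by (simp add: sum_lessThan_4_idx4 matrix_mult_sum column_def vec_eq_iff)
    finally show ?thesis .
  qed
  have inj_scale: "inj (\<lambda>t::complex. t *s w) \<longleftrightarrow> w \<noteq> 0" for w :: "complex^4"
  proof
    assume "inj (\<lambda>t::complex. t *s w)"
    then have "(0::complex) *s w \<noteq> 1 *s w"
      by (metis injD zero_neq_one)
    then show "w \<noteq> 0"
      by auto
  next
    assume "w \<noteq> 0"
    then show "inj (\<lambda>t::complex. t *s w)"
      by (metis injI vec.scale_right_imp_eq)
  qed
  have "globally_injective u \<longleftrightarrow>
        (\<forall>lam. (\<exists>i<4. lam i \<noteq> 0) \<longrightarrow> ?A *v (\<chi> j. lam (idx4 j)) \<noteq> 0)"
    by (simp add: globally_injective_def combination inj_scale)
  also have "\<dots> \<longleftrightarrow> (\<forall>y. y \<noteq> 0 \<longrightarrow> ?A *v y \<noteq> 0)"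
    by (rule all_nonzero_families_iff_all_nonzero_vectors[where P = "\<lambda>y. ?A *v y \<noteq> 0"])
  also have "\<dots> \<longleftrightarrow> inj ((*v) ?A)"
    by (auto simp: vec.inj_iff_eq_0)
  finally show ?thesis .
qed

lemma globally_surjective_iff_functionals_independent:
  assumes rep: "is_rep_141 u v"
  shows "globally_surjective v \<longleftrightarrow>
         (\<forall>c :: complex^4. (\<forall>x. (\<Sum>j\<in>UNIV. c$j * v (idx4 j) x) = 0) \<longrightarrow> c = 0)"
proof -
  have combination: "(\<Sum>i<4. lam i * v i x) = (\<Sum>j\<in>UNIV. (\<chi> j. lam (idx4 j))$j * v (idx4 j) x)"
    for lam x
    by (simp add: sum_lessThan_4_idx4)
  have homogeneous: "(\<Sum>i<4. lam i * v i (s *s x)) = s * (\<Sum>i<4. lam i * v i x)" for lam s x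
    using rep_141_v_scale[OF rep] by (simp add: sum_distrib_left mult_ac)
  have "globally_surjective v \<longleftrightarrow>
        (\<forall>lam. (\<exists>i<4. lam i \<noteq> 0) \<longrightarrow> (\<exists>x. (\<Sum>i<4. lam i * v i x) \<noteq> 0))"
    by (simp add: globally_surjective_def surj_iff_nonzero_if_homogeneous[OF homogeneous])
  also have "\<dots> \<longleftrightarrow>
        (\<forall>lam. (\<exists>i<4. lam i \<noteq> 0) \<longrightarrow>
           (\<exists>x. (\<Sum>j\<in>UNIV. (\<chi> j. lam (idx4 j))$j * v (idx4 j) x) \<noteq> 0))"
    by (simp only: combination)
  also have "\<dots> \<longleftrightarrow> (\<forall>c :: complex^4. c \<noteq> 0 \<longrightarrow> (\<exists>x. (\<Sum>j\<in>UNIV. c$j * v (idx4 j) x) \<noteq> 0))"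
    by (rule all_nonzero_families_iff_all_nonzero_vectors
        [where P = "\<lambda>c. \<exists>x. (\<Sum>j\<in>UNIV. c$j * v (idx4 j) x) \<noteq> 0"])
  finally show ?thesis
    by blast
qed

lemma subrep_1b1_iff_proper_subspace:
  assumes rep: "is_rep_141 u v"
  shows "(\<exists>b\<in>{0..3}. has_subrep_dimvec u v 1 b 1) \<longleftrightarrow>
         (\<exists>W. vec.subspace W \<and> W \<noteq> UNIV \<and> (\<forall>i<4. u i 1 \<in> W))"
proof
  assume "\<exists>b\<in>{0..3}. has_subrep_dimvec u v 1 b 1"
  then obtain b Wm W0 where b: "b \<le> 3" and W0: "vec.subspace W0" "vec.dim W0 = b"
    and Wm: "vector_space_over_itself.dim Wm = 1" and maps_into: "\<forall>i<4. u i ` Wm \<subseteq> W0"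
    unfolding has_subrep_dimvec_def by auto
  obtain t where t: "t \<in> Wm" "t \<noteq> 0"
    using Wm vector_space_over_itself.dim_eq_0[of Wm] by fastforce
  have "u i 1 \<in> W0" if "i < 4" for i
  proof -
    have "t *s u i 1 \<in> W0"
      using maps_into that t(1) rep_141_u_eq_scale[OF rep that] by (metis image_subset_iff)
    then have "inverse t *s (t *s u i 1) \<in> W0"
      using W0(1) vec.subspace_scale by blast
    then show ?thesis
      using t(2) by (simp add: vector_smult_assoc)
  qed
  moreover have "W0 \<noteq> UNIV"
    using subspace_neq_UNIV_iff_dim_less[OF W0(1)] W0(2) b by simp
  ultimately show "\<exists>W. vec.subspace W \<and> W \<noteq> UNIV \<and> (\<forall>i<4. u i 1 \<in> W)"
    using W0(1) by blast
next
  assume "\<exists>W. vec.subspace W \<and> W \<noteq> UNIV \<and> (\<forall>i<4. u i 1 \<in> W)"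
  then obtain W where W: "vec.subspace W" "W \<noteq> UNIV" "\<forall>i<4. u i 1 \<in> W"
    by blast
  have maps_into: "\<forall>i<4. u i ` UNIV \<subseteq> W"
    using W(1,3) rep_141_u_eq_scale[OF rep] vec.subspace_scale by (metis image_subset_iff)
  have "has_subrep_dimvec u v 1 (vec.dim W) 1"
    unfolding has_subrep_dimvec_def
    by (rule exI[of _ UNIV], rule exI[of _ W], rule exI[of _ UNIV])
      (use maps_into in \<open>simp add: W(1) vector_space_over_itself.subspace_UNIV\<close>)
  moreover have "vec.dim W \<le> 3"
    using subspace_neq_UNIV_iff_dim_less[OF W(1)] W(2) by simp
  ultimately show "\<exists>b\<in>{0..3}. has_subrep_dimvec u v 1 b 1"
    by auto
qed

lemma subrep_0b0_iff_common_zero: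
  assumes rep: "is_rep_141 u v"
  shows "(\<exists>b\<in>{1..4}. has_subrep_dimvec u v 0 b 0) \<longleftrightarrow> (\<exists>x. x \<noteq> 0 \<and> (\<forall>i<4. v i x = 0))"
proof
  assume "\<exists>b\<in>{1..4}. has_subrep_dimvec u v 0 b 0"
  then obtain b W0 W1 where "1 \<le> b" "vec.dim W0 = b"
    and W1: "vector_space_over_itself.dim W1 = 0" and maps_into: "\<forall>i<4. v i ` W0 \<subseteq> W1"
    unfolding has_subrep_dimvec_def by auto
  then obtain x where x: "x \<in> W0" "x \<noteq> 0"
    using vec.dim_eq_0[of W0] by fastforce
  moreover have "W1 \<subseteq> {0}"
    using W1 vector_space_over_itself.dim_eq_0 by blast
  ultimately show "\<exists>x. x \<noteq> 0 \<and> (\<forall>i<4. v i x = 0)"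
    using maps_into by blast
next
  assume "\<exists>x. x \<noteq> 0 \<and> (\<forall>i<4. v i x = 0)"
  then obtain x where x: "x \<noteq> 0" "\<forall>i<4. v i x = 0"
    by blast
  have u_into: "\<forall>i<4. u i ` {0} \<subseteq> vec.span {x}"
    using rep_141_u_eq_scale[OF rep _, of _ 0] by (simp add: vec.span_zero)
  have v_into: "\<forall>i<4. v i ` vec.span {x} \<subseteq> {0}"
    using x(2) rep_141_v_scale[OF rep] by (auto simp: vec.span_singleton)
  have "has_subrep_dimvec u v 0 1 0"
    unfolding has_subrep_dimvec_def
    by (rule exI[of _ "{0}"], rule exI[of _ "vec.span {x}"], rule exI[of _ "{0}"])
      (use u_into v_into in \<open>simp add: x(1) vector_space_over_itself.subspace_single_0\<close>)
  then show "\<exists>b\<in>{1..4}. has_subrep_dimvec u v 0 b 0"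
    by force
qed

theorem mainTheorem8:
  fixes u :: "nat \<Rightarrow> complex \<Rightarrow> complex^4" and v :: "nat \<Rightarrow> complex^4 \<Rightarrow> complex"
  assumes "is_rep_141 u v"
  shows "(globally_injective u \<longleftrightarrow> \<not> (\<exists>b\<in>{0..3}. has_subrep_dimvec u v 1 b 1)) \<and>
         (globally_surjective v \<longleftrightarrow> \<not> (\<exists>b\<in>{1..4}. has_subrep_dimvec u v 0 b 0))"
proof
  let ?A = "\<chi> k j. u (idx4 j) 1 $ k :: complex^4^4"
  have columns: "(\<forall>j. column j ?A \<in> W) \<longleftrightarrow> (\<forall>i<4. u i 1 \<in> W)" for W
    using all_lessThan_4_idx4[of "\<lambda>i. u i 1 \<in> W"] by (simp add: column_def)
  show "globally_injective u \<longleftrightarrow> \<not> (\<exists>b\<in>{0..3}. has_subrep_dimvec u v 1 b 1)"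
    unfolding globally_injective_iff_inj_matrix[OF assms] inj_matrix_vector_mult_iff_columns_span
      columns subrep_1b1_iff_proper_subspace[OF assms]
    by blast
next
  have linear: "Vector_Spaces.linear (*s) (*) (v (idx4 j))" for j
    using assms idx4_less unfolding is_rep_141_def by blast
  have common_zero: "(\<forall>j. v (idx4 j) x = 0) \<longleftrightarrow> (\<forall>i<4. v i x = 0)" for x
    using all_lessThan_4_idx4[of "\<lambda>i. v i x = 0"] by simp
  show "globally_surjective v \<longleftrightarrow> \<not> (\<exists>b\<in>{1..4}. has_subrep_dimvec u v 0 b 0)"
    unfolding globally_surjective_iff_functionals_independent[OF assms]
      linear_functionals_independent_iff_no_common_zero[OF linear] common_zero
      subrep_0b0_iff_common_zero[OF assms]
    by blast
qed

end
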